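(* The two-dimensional subalgebras of ${\rm A}_1$ are exactly $\langle e_2,e_3\rangle$, $\langle e_1,e_2\rangle$ and $\langle e_1,\alpha e_2+e_3\rangle$ ($\alpha\in\mathbb{C}$). Up to automorphisms of ${\rm A}_1$, every two-dimensional subalgebra is equivalent to $\langle e_1,e_2\rangle$ or $\langle e_2,e_3\rangle$.
   Context: ${\rm A}_1$ is the complex algebra with basis $e_1,e_2,e_3$ whose only nonzero products of basis elements are $e_1e_i=e_ie_1=e_i$ ($i=1,2,3$). A subalgebra is a linear subspace closed under multiplication (it need not contain $e_1$). Two subalgebras are equivalent up to automorphisms if one is mapped onto the other by an algebra automorphism (invertible linear map $\varphi$ with $\varphi(xy)=\varphi(x)\varphi(y)$). $\langle S\rangle$ denotes the linear span of $S$. *)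

theory Defs
  imports "HOL-Analysis.Analysis"
begin

text \<open>The algebra A1: underlying space complex^3 with basis e1, e2, e3
 (the standard basis vectors), product defined by bilinear extension of the
 multiplication table of basis elements.\<close>

type_synonym A1 = "complex ^ 3"

definition e :: "3 \<Rightarrow> A1" where
  "e i = axis i 1"

abbreviation e1 :: A1 where "e1 \<equiv> e 1"
abbreviation e2 :: A1 where "e2 \<equiv> e 2"
abbreviation e3 :: A1 where "e3 \<equiv> e 3"

text \<open>Products of basis elements: e1 ei = ei e1 = ei, all others zero.\<close>
definition A1_table :: "3 \<Rightarrow> 3 \<Rightarrow> A1" where
  "A1_table i j = (if i = 1 then e j else if j = 1 then e i else 0)"

definition A1_mult :: "A1 \<Rightarrow> A1 \<Rightarrow> A1" where
  "A1_mult x y = (\<Sum>i\<in>UNIV. \<Sum>j\<in>UNIV. (x $ i * y $ j) *s A1_table i j)"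

definition A1_subalgebra :: "A1 set \<Rightarrow> bool" where
  "A1_subalgebra S \<longleftrightarrow> vec.subspace S \<and> (\<forall>x\<in>S. \<forall>y\<in>S. A1_mult x y \<in> S)"

definition A1_automorphism :: "(A1 \<Rightarrow> A1) \<Rightarrow> bool" where
  "A1_automorphism \<phi> \<longleftrightarrow>
     Vector_Spaces.linear ((*s) :: complex \<Rightarrow> A1 \<Rightarrow> A1) (*s) \<phi> \<and> bij \<phi> \<and>
     (\<forall>x y. \<phi> (A1_mult x y) = A1_mult (\<phi> x) (\<phi> y))"

end

theory Submission
  imports Defs
begin

text \<open>In \<open>A\<^sub>1\<close> the product is \<open>x y = x\<^sub>1 y + y\<^sub>1 x - x\<^sub>1 y\<^sub>1 e\<^sub>1\<close>. Hence a subspace is a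
  subalgebra iff it lies in the hyperplane \<open>x\<^sub>1 = 0\<close>, where all products vanish, or
  contains \<open>e\<^sub>1\<close>; the latter is forced as soon as the subspace contains some \<open>y\<close> with
  \<open>y\<^sub>1 = 1\<close>, because then \<open>e\<^sub>1 = 2 y - y y\<close>. A two-dimensional subalgebra is therefore
  either the hyperplane \<open>\<langle>e\<^sub>2, e\<^sub>3\<rangle>\<close> or \<open>\<langle>e\<^sub>1, n\<rangle>\<close> with \<open>n \<noteq> 0\<close>, \<open>n\<^sub>1 = 0\<close>, and scaling \<open>n\<close>
  gives \<open>n = e\<^sub>2\<close> or \<open>n = \<alpha> e\<^sub>2 + e\<^sub>3\<close>. Every linear bijection fixing \<open>e\<^sub>1\<close> and the first
  coordinate is an automorphism, and one of them sends \<open>\<alpha> e\<^sub>2 + e\<^sub>3\<close> to \<open>e\<^sub>2\<close>.\<close>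

context finite_dimensional_vector_space
begin

lemma dim_span_pair:
  assumes "u \<noteq> 0" and "v \<notin> span {u}"
  shows "dim (span {u, v}) = 2"
proof -
  have "dim (insert v {u}) = 2"
    using assms local.dim_insert[of v "{u}"] by simp
  then show ?thesis
    by (simp add: insert_commute)
qed

lemma subspace_eq_span_pair:
  assumes "subspace S" and "dim S = 2" and "u \<in> S" and "v \<in> S"
    and "u \<noteq> 0" and "v \<notin> span {u}"
  shows "S = span {u, v}"
proof -
  have "span {u, v} = S"
  proof (rule local.subspace_dim_equal)
    show "span {u, v} \<subseteq> S"
      using assms by (intro local.span_minimal) auto
  qed (use assms dim_span_pair in auto)
  then show ?thesis ..
qed

lemma exists_not_in_span_singleton:
  assumes "1 < dim S"
  obtains z where "z \<in> S" and "z \<notin> span {u}"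
proof -
  have "\<not> S \<subseteq> span {u}"
    using local.dim_le_card[of S "{u}"] assms by auto
  then show ?thesis
    using that by blast
qed

end

lemma notin_vec_span_singleton:
  fixes u v :: "'a::field ^ 'n"
  assumes "u $ i = 0" and "v $ i \<noteq> 0"
  shows "v \<notin> vec.span {u}"
  using assms by (auto simp: vec.span_singleton)

lemma e_nth [simp]: "e i $ j = (if j = i then 1 else 0)"
  by (simp add: e_def axis_def)

lemma A1_mult_eq: "A1_mult x y = x$1 *s y + y$1 *s x - (x$1 * y$1) *s e1"
  by (simp add: vec_eq_iff forall_3 A1_mult_def A1_table_def sum_3 algebra_simps)

lemma vec_span_e2_e3: "vec.span {e2, e3} = {x. x$1 = 0}"
proof
  show "vec.span {e2, e3} \<subseteq> {x. x$1 = 0}"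
    by (rule vec.span_minimal) (auto simp: vec.subspace_def)
  show "{x. x$1 = 0} \<subseteq> vec.span {e2, e3}"
  proof
    fix x :: A1
    assume "x \<in> {x. x$1 = 0}"
    then have "x = x$2 *s e2 + x$3 *s e3"
      by (auto simp: vec_eq_iff forall_3)
    also have "\<dots> \<in> vec.span {e2, e3}"
      by (intro vec.span_add vec.span_scale vec.span_base) auto
    finally show "x \<in> vec.span {e2, e3}" .
  qed
qed

lemma vec_dim_span_e2_e3: "vec.dim (vec.span {e2, e3}) = 2"
  by (rule vec.dim_span_pair) (auto simp: vec_eq_iff notin_vec_span_singleton[of e2 3])

lemma A1_subalgebra_iff:
  "A1_subalgebra S \<longleftrightarrow> vec.subspace S \<and> (S \<subseteq> {x. x$1 = 0} \<or> e1 \<in> S)"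
proof
  assume S: "A1_subalgebra S"
  then have sub: "vec.subspace S" and mult: "\<And>x y. x \<in> S \<Longrightarrow> y \<in> S \<Longrightarrow> A1_mult x y \<in> S"
    by (auto simp: A1_subalgebra_def)
  have "e1 \<in> S" if "x \<in> S" and "x$1 \<noteq> 0" for x
  proof -
    define y where "y = (1 / x$1) *s x"
    have "y \<in> S"
      using that sub by (simp add: y_def vec.subspace_scale)
    have "A1_mult y y = 2 *s y - e1"
      using that by (simp add: A1_mult_eq y_def vec_eq_iff forall_3)
    then have "e1 = 2 *s y - A1_mult y y"
      by simp
    then show "e1 \<in> S"
      using \<open>y \<in> S\<close> mult sub by (simp add: vec.subspace_diff vec.subspace_scale)
  qed
  then show "vec.subspace S \<and> (S \<subseteq> {x. x$1 = 0} \<or> e1 \<in> S)"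
    using sub by blast
next
  assume "vec.subspace S \<and> (S \<subseteq> {x. x$1 = 0} \<or> e1 \<in> S)"
  then show "A1_subalgebra S"
    unfolding A1_subalgebra_def A1_mult_eq
    by (auto simp: vec.subspace_0 vec.subspace_add vec.subspace_diff vec.subspace_scale)
qed

lemma dim2_subspace_with_e1_cases:
  assumes sub: "vec.subspace S" and dim: "vec.dim S = 2" and "e1 \<in> S"
  shows "S = vec.span {e1, e2} \<or> (\<exists>\<alpha>. S = vec.span {e1, \<alpha> *s e2 + e3})"
proof -
  obtain z where "z \<in> S" and z: "z \<notin> vec.span {e1}"
    using dim vec.exists_not_in_span_singleton[of S e1] by auto
  define n where "n = z - z$1 *s e1"
  have "n \<in> S"
    using \<open>z \<in> S\<close> \<open>e1 \<in> S\<close> sub by (simp add: n_def vec.subspace_diff vec.subspace_scale)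
  have "n$1 = 0"
    by (simp add: n_def)
  have "n \<noteq> 0"
    using z vec.span_base[of e1 "{e1}"] vec.span_scale[of e1 "{e1}" "z$1"]
    by (auto simp: n_def)
  have span_eq: "S = vec.span {e1, w}" if "w \<in> S" and "w \<notin> vec.span {e1}" for w
    by (rule vec.subspace_eq_span_pair) (use sub dim \<open>e1 \<in> S\<close> that in \<open>auto simp: vec_eq_iff\<close>)
  show ?thesis
  proof (cases "n$3 = 0")
    case True
    with \<open>n$1 = 0\<close> \<open>n \<noteq> 0\<close> have "n$2 \<noteq> 0"
      by (auto simp: vec_eq_iff forall_3)
    have "e2 = (1 / n$2) *s n"
      using True \<open>n$1 = 0\<close> \<open>n$2 \<noteq> 0\<close> by (simp add: vec_eq_iff forall_3)
    then have "e2 \<in> S"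
      using \<open>n \<in> S\<close> sub by (simp add: vec.subspace_scale)
    then show ?thesis
      using span_eq notin_vec_span_singleton[of e1 2 e2] by auto
  next
    case False
    define \<alpha> where "\<alpha> = n$2 / n$3"
    have "\<alpha> *s e2 + e3 = (1 / n$3) *s n"
      using False \<open>n$1 = 0\<close> by (simp add: \<alpha>_def vec_eq_iff forall_3)
    then have "\<alpha> *s e2 + e3 \<in> S"
      using \<open>n \<in> S\<close> sub by (simp add: vec.subspace_scale)
    then show ?thesis
      using span_eq notin_vec_span_singleton[of e1 3 "\<alpha> *s e2 + e3"] by auto
  qed
qed

lemma A1_subalgebra_dim2_cases:
  assumes "A1_subalgebra S" and dim: "vec.dim S = 2"
  shows "S = vec.span {e2, e3} \<or> S = vec.span {e1, e2} \<or>
         (\<exists>\<alpha>. S = vec.span {e1, \<alpha> *s e2 + e3})"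
proof -
  have sub: "vec.subspace S" and "S \<subseteq> vec.span {e2, e3} \<or> e1 \<in> S"
    using assms(1) by (auto simp: A1_subalgebra_iff vec_span_e2_e3)
  then consider "S \<subseteq> vec.span {e2, e3}" | "e1 \<in> S"
    by blast
  then show ?thesis
  proof cases
    case 1
    then have "S = vec.span {e2, e3}"
      using dim sub vec_dim_span_e2_e3 by (intro vec.subspace_dim_equal) auto
    then show ?thesis ..
  next
    case 2
    then show ?thesis
      using dim2_subspace_with_e1_cases[OF sub dim] by blast
  qed
qed

lemma A1_subalgebra_dim2_listed:
  assumes "S = vec.span {e2, e3} \<or> S = vec.span {e1, e2} \<or>
           (\<exists>\<alpha>. S = vec.span {e1, \<alpha> *s e2 + e3})"
  shows "A1_subalgebra S \<and> vec.dim S = 2"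
proof -
  have e1_nonzero: "e1 \<noteq> 0"
    by (simp add: vec_eq_iff)
  have "A1_subalgebra (vec.span {e2, e3})"
    by (simp add: A1_subalgebra_iff vec_span_e2_e3 vec.subspace_def)
  moreover have "A1_subalgebra (vec.span (insert e1 B))" for B
    by (simp add: A1_subalgebra_iff vec.span_base)
  moreover have "vec.dim (vec.span {e1, e2}) = 2"
    using e1_nonzero notin_vec_span_singleton[of e1 2 e2] by (intro vec.dim_span_pair) auto
  moreover have "vec.dim (vec.span {e1, \<alpha> *s e2 + e3}) = 2" for \<alpha>
    using e1_nonzero notin_vec_span_singleton[of e1 3 "\<alpha> *s e2 + e3"]
    by (intro vec.dim_span_pair) auto
  ultimately show ?thesis
    using assms vec_dim_span_e2_e3 by blast
qed

lemma A1_automorphismI: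
  assumes lin: "Vector_Spaces.linear ((*s) :: complex \<Rightarrow> A1 \<Rightarrow> A1) (*s) f"
    and "bij f" and "f e1 = e1" and "\<And>x. f x $ 1 = x $ 1"
  shows "A1_automorphism f"
  unfolding A1_automorphism_def
  using assms by (simp add: A1_mult_eq vec.linear_add[OF lin] vec.linear_diff[OF lin]
      vec.linear_scale[OF lin])

definition A1_line_to_e2 :: "complex \<Rightarrow> A1 \<Rightarrow> A1" where
  "A1_line_to_e2 \<alpha> x = vector [x$1, x$3, x$2 - \<alpha> * x$3]"

lemma A1_automorphism_line_to_e2: "A1_automorphism (A1_line_to_e2 \<alpha>)"
proof (rule A1_automorphismI)
  show "Vector_Spaces.linear (*s) (*s) (A1_line_to_e2 \<alpha>)"
    unfolding Vector_Spaces.linear_iff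
    by (simp add: vec.vector_space_axioms A1_line_to_e2_def vec_eq_iff forall_3 algebra_simps)
  show "bij (A1_line_to_e2 \<alpha>)"
    by (rule o_bij[where g = "\<lambda>y. vector [y$1, y$3 + \<alpha> * y$2, y$2]"])
       (simp_all add: A1_line_to_e2_def fun_eq_iff vec_eq_iff forall_3)
qed (simp_all add: A1_line_to_e2_def vec_eq_iff forall_3)

lemma A1_line_to_e2_image:
  "A1_line_to_e2 \<alpha> ` vec.span {e1, \<alpha> *s e2 + e3} = vec.span {e1, e2}"
proof -
  have lin: "Vector_Spaces.linear (*s) (*s) (A1_line_to_e2 \<alpha>)"
    using A1_automorphism_line_to_e2 by (simp add: A1_automorphism_def)
  have "A1_line_to_e2 \<alpha> e1 = e1" and "A1_line_to_e2 \<alpha> (\<alpha> *s e2 + e3) = e2"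
    by (simp_all add: A1_line_to_e2_def vec_eq_iff forall_3)
  then have "A1_line_to_e2 \<alpha> ` {e1, \<alpha> *s e2 + e3} = {e1, e2}"
    by simp
  then show ?thesis
    using vec.linear_span_image[OF lin] by metis
qed

theorem mainTheorem5:
  shows "(\<forall>S. (A1_subalgebra S \<and> vec.dim S = 2) \<longleftrightarrow>
            (S = vec.span {e2, e3} \<or> S = vec.span {e1, e2} \<or>
             (\<exists>\<alpha>::complex. S = vec.span {e1, \<alpha> *s e2 + e3})))
       \<and> (\<forall>S. A1_subalgebra S \<and> vec.dim S = 2 \<longrightarrow>
            (\<exists>\<phi>. A1_automorphism \<phi> \<and>
                 (\<phi> ` S = vec.span {e1, e2} \<or> \<phi> ` S = vec.span {e2, e3})))"
proof (intro conjI allI impI iffI)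
  fix S
  assume "A1_subalgebra S \<and> vec.dim S = 2"
  then have cases: "S = vec.span {e2, e3} \<or> S = vec.span {e1, e2} \<or>
                    (\<exists>\<alpha>. S = vec.span {e1, \<alpha> *s e2 + e3})"
    using A1_subalgebra_dim2_cases by blast
  then show "S = vec.span {e2, e3} \<or> S = vec.span {e1, e2} \<or>
             (\<exists>\<alpha>. S = vec.span {e1, \<alpha> *s e2 + e3})" .
  have "A1_automorphism id"
    by (simp add: A1_automorphism_def vec.linear_id)
  with cases show "\<exists>\<phi>. A1_automorphism \<phi> \<and> (\<phi> ` S = vec.span {e1, e2} \<or> \<phi> ` S = vec.span {e2, e3})"
  proof (elim disjE exE)
    fix \<alpha>
    assume "S = vec.span {e1, \<alpha> *s e2 + e3}"
    then show ?thesis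
      using A1_automorphism_line_to_e2 A1_line_to_e2_image by blast
  qed force+
qed (use A1_subalgebra_dim2_listed in blast)+

end
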